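(* Let $f:X\to X$ be a continuous map of a compact metric space $X$ and let $A$ be a nonempty closed $f$-invariant subset of $X$ all of whose points are periodic points of $f$. If $A$ has the weak incompressibility property, then $A$ has finitely many connected components, and they form a periodic cycle; that is, they can be labelled $C_0,\dots,C_{N-1}$ (where $N\geq 1$ is the number of components) so that $f(C_i)=C_{(i+1) \bmod N}$ for every $i\in\{0,\dots,N-1\}$.
   Context: A subset $A$ of $X$ is $f$-invariant if $f(A)\subset A$. A point $x$ is periodic if $f^n(x)=x$ for some integer $n\geq 1$. A subset $L$ of $X$ has the weak incompressibility property (for $f$) if $F\cap\overline{f(L\setminus F)}\neq\emptyset$ whenever $F$ is a proper, nonempty, closed subset of $L$. *)

theory Defs
  imports "HOL-Analysis.Analysis"
begin

definition invariant_set :: "('a \<Rightarrow> 'a) \<Rightarrow> 'a set \<Rightarrow> bool" where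
  "invariant_set f A \<longleftrightarrow> f ` A \<subseteq> A"

definition periodic_point :: "('a \<Rightarrow> 'a) \<Rightarrow> 'a \<Rightarrow> bool" where
  "periodic_point f x \<longleftrightarrow> (\<exists>n\<ge>1. (f ^^ n) x = x)"

(* "Closed subset of L" is read as relatively closed in L; for closed L this is the
   same as closed in the ambient space.  The closure is taken in the ambient type: for
   L contained in a space X and F a subset of L, F meets the closure in X iff it meets
   the closure in the type, so X is not a parameter. *)
definition weakly_incompressible ::
    "('a::topological_space \<Rightarrow> 'a) \<Rightarrow> 'a set \<Rightarrow> bool" where
  "weakly_incompressible f L \<longleftrightarrow>
     (\<forall>F. closedin (top_of_set L) F \<and> F \<noteq> {} \<and> F \<noteq> L
        \<longrightarrow> F \<inter> closure (f ` (L - F)) \<noteq> {})"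

end

theory Submission
  imports Defs
begin

text \<open>
  Let \<open>U\<close> be clopen in \<open>A\<close>. The points whose first \<open>n\<close> iterates stay in \<open>U\<close> form a
  decreasing sequence of clopen sets, which becomes constant: otherwise compactness yields
  a point \<open>y \<notin> U\<close> whose whole past under the bijection \<open>f\<close> lies in \<open>U\<close>, contradicting the
  periodicity of \<open>y\<close>. Hence the points that never leave \<open>U\<close> form a clopen invariant set, which
  by weak incompressibility is empty or all of \<open>A\<close>; so a clopen set containing a whole orbit
  is \<open>A\<close>. As components of a compact Hausdorff space are intersections of clopen sets, the
  finitely many components through one orbit exhaust \<open>A\<close>, and \<open>f\<close> permutes them cyclically.
\<close>

section \<open>Iterates of a map on a set of periodic points\<close>

lemma funpow_mem_invariant:
  assumes "invariant_set f A" "x \<in> A"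
  shows "(f ^^ n) x \<in> A"
  using assms by (induction n) (auto simp: invariant_set_def)

lemma continuous_on_funpow:
  assumes "continuous_on A f" "invariant_set f A"
  shows "continuous_on A (f ^^ n)"
proof (induction n)
  case (Suc n)
  have "(f ^^ n) ` A \<subseteq> A"
    using funpow_mem_invariant[OF assms(2)] by blast
  then show ?case
    using continuous_on_compose[OF Suc continuous_on_subset[OF assms(1)]] by simp
qed simp

lemma funpow_mult_period:
  assumes "(f ^^ p) x = x"
  shows "(f ^^ (p * k)) x = x"
  using assms by (induction k) (simp_all add: funpow_add)

text \<open>If \<open>p\<close> and \<open>q\<close> are periods of the two points, then
  \<open>f ^^ (p * q * n)\<close> fixes both. Since \<open>p * q \<ge> 1\<close>, this iterate
  factors as \<open>f ^^ m\<close> after \<open>f ^^ n\<close>, so the common value under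
  \<open>f ^^ n\<close> determines the point.\<close>

lemma periodic_point_funpow_inj:
  assumes "periodic_point f x" "periodic_point f y" and eq: "(f ^^ n) x = (f ^^ n) y"
  shows "x = y"
proof -
  obtain p q where p: "p \<ge> 1" "(f ^^ p) x = x" and q: "q \<ge> 1" "(f ^^ q) y = y"
    using assms(1,2) by (auto simp: periodic_point_def)
  obtain m where m: "p * q * n = m + n"
    using p(1) q(1) by (metis add.commute le_add_diff_inverse mult_le_mono1 nat_mult_1 mult_le_mono)
  have "x = (f ^^ (p * (q * n))) x" "y = (f ^^ (q * (p * n))) y"
    by (simp_all only: funpow_mult_period[OF p(2)] funpow_mult_period[OF q(2)])
  then have "x = (f ^^ (m + n)) x" "y = (f ^^ (m + n)) y"
    by (simp_all add: m[symmetric] ac_simps)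
  then show ?thesis
    by (metis eq comp_apply funpow_add)
qed

section \<open>Clopen sets and the orbits that stay in them\<close>

lemma clopen_iterated_preimage:
  fixes A :: "'a::topological_space set"
  assumes "continuous_on A f" "invariant_set f A"
    and "openin (top_of_set A) U" "closedin (top_of_set A) U"
  shows "openin (top_of_set A) {z \<in> A. \<forall>i\<le>n. (f ^^ i) z \<in> U}"
    and "closedin (top_of_set A) {z \<in> A. \<forall>i\<le>n. (f ^^ i) z \<in> U}"
proof -
  have eq: "{z \<in> A. \<forall>i\<le>n. (f ^^ i) z \<in> U} = (\<Inter>i\<in>{..n}. A \<inter> (f ^^ i) -` U)"
    by auto
  have maps: "(f ^^ i) \<in> A \<rightarrow> A" for i
    using funpow_mem_invariant[OF assms(2)] by blast
  show "openin (top_of_set A) {z \<in> A. \<forall>i\<le>n. (f ^^ i) z \<in> U}"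
    unfolding eq
    by (intro openin_INT2 continuous_openin_preimage[OF continuous_on_funpow[OF assms(1,2)] maps assms(3)]) auto
  show "closedin (top_of_set A) {z \<in> A. \<forall>i\<le>n. (f ^^ i) z \<in> U}"
    unfolding eq
    by (intro closedin_INT continuous_closedin_preimage_gen[OF continuous_on_funpow[OF assms(1,2)] maps assms(4)]) auto
qed

lemma iterated_preimages_stabilize:
  fixes A :: "'a::t2_space set"
  assumes "compact A" "continuous_on A f" "invariant_set f A"
    and per: "\<And>x. x \<in> A \<Longrightarrow> periodic_point f x"
    and U: "openin (top_of_set A) U" "closedin (top_of_set A) U"
  obtains n where
    "{z \<in> A. \<forall>i\<le>Suc n. (f ^^ i) z \<in> U} = {z \<in> A. \<forall>i\<le>n. (f ^^ i) z \<in> U}"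
proof -
  define V where "V n = {z \<in> A. \<forall>i\<le>n. (f ^^ i) z \<in> U}" for n
  \<comment> \<open>These are the exit points: a point of \<open>W n\<close> lies outside
    \<open>U\<close> and is reached after \<open>n + 1\<close> successive points in
    \<open>U\<close>. The set is empty exactly when \<open>V\<close> does not shrink from
    \<open>n\<close> to \<open>Suc n\<close>.\<close>
  define W where "W n = (f ^^ Suc n) ` (V n - V (Suc n))" for n
  have mem: "(f ^^ n) x \<in> A" if "x \<in> A" for n x
    using funpow_mem_invariant[OF assms(3) that] .
  have W_sub: "W n \<subseteq> A - U" for n
    unfolding W_def V_def using mem by (auto simp: le_Suc_eq simp del: funpow.simps)
  have "closedin (top_of_set A) (W n)" for n
  proof -
    have "closedin (top_of_set A) (V n - V (Suc n))"
      unfolding V_def by (intro closedin_diff clopen_iterated_preimage assms)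
    then have "compact (V n - V (Suc n))"
      using \<open>compact A\<close> closedin_compact by blast
    then have "compact (W n)"
      unfolding W_def
      by (intro compact_continuous_image continuous_on_subset[OF continuous_on_funpow[OF assms(2,3)]])
        (auto simp: V_def)
    then show ?thesis
      using W_sub[of n] by (auto intro: closed_subset compact_imp_closed)
  qed
  moreover have "decseq W"
  proof (rule decseq_SucI, rule subsetI)
    fix n y assume "y \<in> W (Suc n)"
    then obtain v where v: "v \<in> V (Suc n)" "v \<notin> V (Suc (Suc n))" "y = (f ^^ Suc (Suc n)) v"
      by (auto simp: W_def)
    have shift: "(f ^^ i) (f v) = (f ^^ Suc i) v" for i
      by (simp add: funpow_swap1)
    have "v \<in> A" and vU: "\<And>i. i \<le> Suc n \<Longrightarrow> (f ^^ i) v \<in> U"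
      using v(1) by (auto simp: V_def)
    then have fv: "f v \<in> A" using mem[of v 1] by simp
    \<comment> \<open>Replacing \<open>v\<close> by \<open>f v\<close> forgets the oldest point of
      the history, which turns an exit after \<open>n + 2\<close> points into an exit after
      \<open>n + 1\<close>.\<close>
    have "f v \<in> V n"
      unfolding V_def using fv vU by (auto simp: shift simp del: funpow.simps)
    moreover have "(f ^^ Suc (Suc n)) v \<notin> U"
      using v(2) vU \<open>v \<in> V (Suc n)\<close> unfolding V_def by (auto simp: le_Suc_eq simp del: funpow.simps)
    then have "f v \<notin> V (Suc n)"
      unfolding V_def by (auto simp: shift simp del: funpow.simps)
    moreover have "y = (f ^^ Suc n) (f v)"
      using v(3) shift by simp
    ultimately show "y \<in> W n"
      unfolding W_def by blast
  qed
  moreover have "(\<Inter>n. W n) = {}"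
  proof (rule ccontr)
    assume "(\<Inter>n. W n) \<noteq> {}"
    then obtain y where y: "y \<in> W n" for n by blast
    then have yA: "y \<in> A" "y \<notin> U" using W_sub[of 0] by blast+
    then obtain p where p: "p \<ge> 1" "(f ^^ p) y = y"
      using per[OF yA(1)] unfolding periodic_point_def by blast
    \<comment> \<open>The index \<open>p - 1\<close> makes the history exactly one period long. Then
      \<open>v\<close> and \<open>y\<close> both have the image \<open>y\<close> under
      \<open>f ^^ p\<close>, so injectivity forces \<open>v = y\<close>, although \<open>v\<close>
      is in \<open>U\<close> and \<open>y\<close> is not.\<close>
    obtain v where v: "v \<in> V (p - 1)" "y = (f ^^ p) v"
      using y[of "p - 1"] p(1) by (auto simp: W_def simp del: funpow.simps)
    then have "v \<in> A" "v \<in> U" unfolding V_def by force+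
    then have "y = v"
      using periodic_point_funpow_inj[of f y v p] per yA(1) p(2) v(2) by simp
    then show False using \<open>v \<in> U\<close> yA(2) by simp
  qed
  moreover have "compact_space (top_of_set A)"
    using \<open>compact A\<close> by (simp add: compact_space_subtopology)
  \<comment> \<open>In a compact space a decreasing sequence of nonempty closed sets has a common
    point, so some \<open>W n\<close> must be empty.\<close>
  ultimately obtain n where "W n = {}"
    using compact_space_imp_nest[of "top_of_set A" W] by blast
  then have "V n \<subseteq> V (Suc n)"
    by (auto simp: W_def)
  moreover have "V (Suc n) \<subseteq> V n"
    by (auto simp: V_def)
  ultimately show thesis
    using that[of n] unfolding V_def by blast
qed

lemma clopen_superset_of_orbit_eq:
  fixes A :: "'a::t2_space set"
  assumes "compact A" "continuous_on A f" "invariant_set f A"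
    and per: "\<And>x. x \<in> A \<Longrightarrow> periodic_point f x"
    and "weakly_incompressible f A"
    and U: "openin (top_of_set A) U" "closedin (top_of_set A) U"
    and x: "x \<in> A" "\<And>i. (f ^^ i) x \<in> U"
  shows "U = A"
proof -
  obtain n where n: "{z \<in> A. \<forall>i\<le>Suc n. (f ^^ i) z \<in> U} = {z \<in> A. \<forall>i\<le>n. (f ^^ i) z \<in> U}"
    using iterated_preimages_stabilize[OF assms(1-3) per U] .
  define V where "V = {z \<in> A. \<forall>i\<le>n. (f ^^ i) z \<in> U}"
  have clopen: "openin (top_of_set A) V" "closedin (top_of_set A) V"
    unfolding V_def using clopen_iterated_preimage[OF assms(2,3) U] by blast+
  \<comment> \<open>By stabilization a point of \<open>V\<close> stays in \<open>U\<close> for one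
    step more than \<open>V\<close> demands, and its image can spend that step.\<close>
  have "f z \<in> V" if "z \<in> V" for z
  proof -
    have "z \<in> A" and z: "\<And>i. i \<le> Suc n \<Longrightarrow> (f ^^ i) z \<in> U"
      using \<open>z \<in> V\<close> unfolding V_def n[symmetric] by blast+
    then show ?thesis
      using z[of "Suc _"] assms(3) by (auto simp: V_def invariant_set_def funpow_swap1)
  qed
  then have inv: "f ` V \<subseteq> V" by blast
  have "closed V"
    using \<open>compact A\<close> clopen(2) closedin_compact compact_imp_closed by blast
  then have "closure (f ` V) \<subseteq> V"
    using inv closure_minimal by blast
  moreover have "V \<subseteq> A" "x \<in> V"
    using x by (auto simp: V_def)
  moreover have "closedin (top_of_set A) (A - V)"
    using clopen(1) by (simp add: closedin_diff)
  \<comment> \<open>Weak incompressibility is tested on \<open>F = A - V\<close>: here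
    \<open>L - F\<close> is \<open>V\<close>, and the closure of its image stays inside
    \<open>V\<close>, so it misses \<open>F\<close>. As \<open>x\<close> lies in \<open>V\<close>,
    \<open>F\<close> is not all of \<open>A\<close>, which leaves only the empty set.\<close>
  ultimately have "A - V = {}"
    using \<open>weakly_incompressible f A\<close> x(1) double_diff[of V A A]
    unfolding weakly_incompressible_def by (smt (verit) DiffE Diff_disjoint disjoint_iff subsetD order_refl)
  then have "A \<subseteq> U"
    unfolding V_def by fastforce
  then show ?thesis
    using openin_imp_subset[OF U(1)] by blast
qed

section \<open>Components of a compact set and the orbit through them\<close>

lemma clopen_separation_of_components:
  fixes A :: "'a::t2_space set"
  assumes "compact A" "x \<in> A" "y \<in> A" "y \<notin> connected_component_set A x"
  obtains U where "openin (top_of_set A) U" "closedin (top_of_set A) U" "x \<in> U" "y \<notin> U"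
proof -
  have "\<not> connected_component_of (top_of_set A) x y"
    using assms(4) by (auto simp: connected_component_of_def connected_component_def connectedin_subtopology)
  moreover have "Hausdorff_space (euclidean :: 'a topology)"
    by (simp add: Hausdorff_space_def disjnt_def) (meson hausdorff)
  then have "Hausdorff_space (top_of_set A)"
    by (rule Hausdorff_space_subtopology)
  moreover have "compact_space (top_of_set A)"
    using \<open>compact A\<close> by (simp add: compact_space_subtopology)
  \<comment> \<open>In a compact Hausdorff space components and quasi-components coincide, and
    distinct quasi-components are separated by clopen sets.\<close>
  ultimately have "\<not> quasi_component_of (top_of_set A) x y"
    using quasi_eq_connected_component_of[of "top_of_set A" x] by simp
  then show thesis
    using assms(2,3) that unfolding quasi_component_of by auto
qed

lemma orbit_meets_every_component:
  fixes A :: "'a::t2_space set"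
  assumes "compact A" "continuous_on A f" "invariant_set f A"
    and per: "\<And>x. x \<in> A \<Longrightarrow> periodic_point f x"
    and "weakly_incompressible f A"
    and "x \<in> A" "y \<in> A"
  shows "\<exists>i. y \<in> connected_component_set A ((f ^^ i) x)"
proof (rule ccontr)
  assume none: "\<nexists>i. y \<in> connected_component_set A ((f ^^ i) x)"
  obtain p where p: "p \<ge> 1" "(f ^^ p) x = x"
    using per[OF \<open>x \<in> A\<close>] unfolding periodic_point_def by blast
  have "\<exists>U. openin (top_of_set A) U \<and> closedin (top_of_set A) U \<and> (f ^^ i) x \<in> U \<and> y \<notin> U" for i
    using clopen_separation_of_components[OF \<open>compact A\<close> funpow_mem_invariant[OF assms(3,6)] \<open>y \<in> A\<close>] none
    by metis
  then obtain U where U: "\<And>i. openin (top_of_set A) (U i)" "\<And>i. closedin (top_of_set A) (U i)"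
      "\<And>i. (f ^^ i) x \<in> U i" "\<And>i. y \<notin> U i"
    by metis
  \<comment> \<open>Reducing \<open>i\<close> modulo the period of \<open>x\<close> shows that
    \<open>p\<close> of the sets cover the whole orbit. Finiteness keeps their union closed, while
    \<open>y\<close> is still left out.\<close>
  have "(f ^^ i) x \<in> (\<Union>i<p. U i)" for i
    using U(3)[of "i mod p"] p by (auto simp: funpow_mod_eq intro!: bexI[of _ "i mod p"])
  moreover have "openin (top_of_set A) (\<Union>i<p. U i)"
    using U(1) by blast
  moreover have "closedin (top_of_set A) (\<Union>i<p. U i)"
    using U(2) by (intro closedin_Union) auto
  ultimately have "(\<Union>i<p. U i) = A"
    using clopen_superset_of_orbit_eq[OF assms(1-3) per assms(5) _ _ \<open>x \<in> A\<close>] by blast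
  then show False
    using U(4) \<open>y \<in> A\<close> by blast
qed

section \<open>Images of components\<close>

lemma image_component_subset:
  assumes "continuous_on A f" "invariant_set f A" "x \<in> A"
  shows "f ` connected_component_set A x \<subseteq> connected_component_set A (f x)"
proof (rule connected_component_maximal)
  show "f x \<in> f ` connected_component_set A x"
    using \<open>x \<in> A\<close> by auto
  show "connected (f ` connected_component_set A x)"
    by (intro connected_continuous_image continuous_on_subset[OF assms(1)]
        connected_connected_component connected_component_subset)
  show "f ` connected_component_set A x \<subseteq> A"
    using assms(2) connected_component_subset[of A x] unfolding invariant_set_def by blast
qed

lemma funpow_image_component_subset:
  assumes "continuous_on A f" "invariant_set f A" "x \<in> A"
  shows "(f ^^ n) ` connected_component_set A x \<subseteq> connected_component_set A ((f ^^ n) x)"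
proof (rule image_component_subset)
  show "invariant_set (f ^^ n) A"
    using funpow_mem_invariant[OF assms(2)] unfolding invariant_set_def by blast
qed (use assms continuous_on_funpow in auto)

text \<open>Only surjectivity goes beyond continuity. For a given target point \<open>w\<close>, a
  suitable iterate of \<open>f\<close> acts as an inverse of \<open>f\<close> both at
  \<open>w\<close> and along the orbit of \<open>x\<close>, and it carries components into
  components.\<close>

lemma image_component_eq:
  assumes "continuous_on A f" "invariant_set f A"
    and per: "\<And>x. x \<in> A \<Longrightarrow> periodic_point f x" and "x \<in> A"
  shows "f ` connected_component_set A x = connected_component_set A (f x)"
proof
  show "f ` connected_component_set A x \<subseteq> connected_component_set A (f x)"
    using image_component_subset assms(1,2,4) .
  show "connected_component_set A (f x) \<subseteq> f ` connected_component_set A x"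
  proof
    fix w assume w: "w \<in> connected_component_set A (f x)"
    then have "w \<in> A" using connected_component_subset by blast
    then obtain q where q: "q \<ge> 1" "(f ^^ q) w = w"
      using per unfolding periodic_point_def by blast
    obtain p where p: "p \<ge> 1" "(f ^^ p) x = x"
      using per[OF \<open>x \<in> A\<close>] unfolding periodic_point_def by blast
    \<comment> \<open>With \<open>m + 1\<close> a common multiple of the periods of \<open>x\<close>
      and \<open>w\<close>, the iterate \<open>f ^^ m\<close> sends \<open>f x\<close> back to
      \<open>x\<close> and sends \<open>w\<close> to a preimage of \<open>w\<close>.\<close>
    obtain m where m: "p * q = Suc m"
      using p(1) q(1) by (cases "p * q") auto
    have "(f ^^ m) (f x) = x"
      using funpow_mult_period[OF p(2), of q] by (simp add: m funpow_swap1)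
    moreover have "f x \<in> A"
      using assms(2,4) by (auto simp: invariant_set_def)
    ultimately have "(f ^^ m) w \<in> connected_component_set A x"
      using funpow_image_component_subset[OF assms(1,2), of "f x" m] w by auto
    moreover have "f ((f ^^ m) w) = w"
      using funpow_mult_period[OF q(2), of p] m by (simp add: mult.commute)
    ultimately show "w \<in> f ` connected_component_set A x"
      by (metis imageI)
  qed
qed

section \<open>Cyclic labelling of the components\<close>

lemma cyclic_labelling_of_periodic_orbit:
  assumes "p \<ge> 1" "(F ^^ p) c = c"
  obtains N where "N \<ge> 1" "bij_betw (\<lambda>i. (F ^^ i) c) {..<N} (range (\<lambda>i. (F ^^ i) c))"
    "(F ^^ N) c = c"
proof -
  define N where "N = (LEAST n. n \<ge> 1 \<and> (F ^^ n) c = c)"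
  have N: "N \<ge> 1" "(F ^^ N) c = c"
    using LeastI[of "\<lambda>n. n \<ge> 1 \<and> (F ^^ n) c = c" p] assms unfolding N_def by auto
  have least: "N \<le> n" if "n \<ge> 1" "(F ^^ n) c = c" for n
    unfolding N_def using that by (intro Least_le) auto
  have "(F ^^ i) c \<noteq> (F ^^ j) c" if "i < j" "j < N" for i j
  proof
    assume eq: "(F ^^ i) c = (F ^^ j) c"
    \<comment> \<open>Applying \<open>F ^^ (N - i)\<close> to both sides closes the cycle on the
      left and leaves \<open>F ^^ (j - i)\<close> on the right, so \<open>j - i\<close> would be a
      positive return time below the least one.\<close>
    have "(F ^^ (N - i + i)) c = (F ^^ (N - i + j)) c"
      using eq by (simp only: funpow_add o_apply)
    also have "N - i + i = N"
      using that by simp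
    also have "N - i + j = (j - i) + N"
      using that by simp
    finally have "(F ^^ (j - i)) c = c"
      using N(2) by (simp add: funpow_add)
    then show False
      using least[of "j - i"] that by linarith
  qed
  then have "inj_on (\<lambda>i. (F ^^ i) c) {..<N}"
    by (intro linorder_inj_onI') auto
  moreover have "(F ^^ i) c \<in> (\<lambda>i. (F ^^ i) c) ` {..<N}" for i
    using N by (intro image_eqI[of _ _ "i mod N"]) (simp_all add: funpow_mod_eq)
  then have "(\<lambda>i. (F ^^ i) c) ` {..<N} = range (\<lambda>i. (F ^^ i) c)"
    by blast
  ultimately show thesis
    using that N unfolding bij_betw_def by blast
qed

theorem theorem3p1:
  fixes X A :: "'a::metric_space set" and f :: "'a \<Rightarrow> 'a"
  assumes "compact X"
    and "continuous_on X f"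
    and "f ` X \<subseteq> X"
    and "A \<subseteq> X"
    and "A \<noteq> {}"
    and "closedin (top_of_set X) A"
    and "invariant_set f A"
    and "\<And>x. x \<in> A \<Longrightarrow> periodic_point f x"
    and "weakly_incompressible f A"
  shows "finite (components A) \<and>
    (\<exists>N C. N \<ge> 1 \<and> N = card (components A) \<and>
       bij_betw C {..<N} (components A) \<and>
       (\<forall>i<N. f ` C i = C ((i + 1) mod N)))"
proof -
  have A: "compact A" "continuous_on A f"
    using assms(1,2,4,6) closedin_compact continuous_on_subset by blast+
  note per = assms(8)
  obtain x where "x \<in> A"
    using \<open>A \<noteq> {}\<close> by blast
  obtain p where p: "p \<ge> 1" "(f ^^ p) x = x"
    using per[OF \<open>x \<in> A\<close>] unfolding periodic_point_def by blast
  define C where "C i = ((`) f ^^ i) (connected_component_set A x)" for i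
  have C_eq: "C i = connected_component_set A ((f ^^ i) x)" for i
  proof (induction i)
    case (Suc i)
    then show ?case
      using image_component_eq[OF A(2) assms(7) per funpow_mem_invariant[OF assms(7) \<open>x \<in> A\<close>]]
      by (simp add: C_def)
  qed (simp add: C_def)
  have "((`) f ^^ p) (connected_component_set A x) = connected_component_set A x"
    using C_eq[of p] p(2) by (simp add: C_def)
  then obtain N where N: "N \<ge> 1" "bij_betw C {..<N} (range C)" "C N = C 0"
    using cyclic_labelling_of_periodic_orbit[OF p(1), of "(`) f" "connected_component_set A x"]
    unfolding C_def[abs_def] by auto
  have "range C = components A"
  proof
    show "range C \<subseteq> components A"
      using funpow_mem_invariant[OF assms(7) \<open>x \<in> A\<close>] by (auto simp: C_eq intro: componentsI)
    show "components A \<subseteq> range C"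
    proof
      fix D assume "D \<in> components A"
      then obtain y where y: "y \<in> A" "D = connected_component_set A y"
        by (auto simp: components_iff)
      obtain i where "y \<in> connected_component_set A ((f ^^ i) x)"
        using orbit_meets_every_component[OF A assms(7) per assms(9) \<open>x \<in> A\<close> y(1)] by blast
      then have "D = C i"
        using y(2) C_eq connected_component_eq by metis
      then show "D \<in> range C" by blast
    qed
  qed
  then have bij: "bij_betw C {..<N} (components A)"
    using N(2) by simp
  \<comment> \<open>Only the last index wraps around, where \<open>C N = C 0\<close> closes the
    cycle.\<close>
  have "f ` C i = C ((i + 1) mod N)" if "i < N" for i
  proof (cases "Suc i = N")
    case True
    then show ?thesis using N(3) by (auto simp: C_def)
  next
    case False
    then show ?thesis using that by (simp add: C_def)
  qed
  then show ?thesis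
    using bij N(1) bij_betw_finite[OF bij] bij_betw_same_card[OF bij] by auto
qed

end
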